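(* Let $s^c = (s^c_K)_{\tau^c_K \in \mathcal{T}^c}$ and $\sigma^c = (\sigma^c_i)_{\varepsilon^c_i \in \mathcal{E}^c}$ be the coefficient vectors of a coarse saturation and a coarse flux, respectively. Define $U^c(\sigma^c)\in\mathbb{R}^{\mathcal{E}^c\times\mathcal{T}^c}$ to be the matrix such that, for $\varepsilon^c_i=\varepsilon^c_{K,L}$, $$ [U^c(\sigma^c)]_{ij} = \begin{cases} \delta_{jK}\displaystyle\sum_{\varepsilon_k \subseteq \varepsilon^c_i} \max\left( [ P_{\sigma} ]_{ki}, 0 \right) + \delta_{jL} \sum_{\varepsilon_k \subseteq \varepsilon^c_i} \min\left( [ P_{\sigma} ]_{ki}, 0 \right), & \text{if } \sigma^c_i > 0, \\ \delta_{jK}\displaystyle\sum_{\varepsilon_k \subseteq \varepsilon^c_i} \min\left( [ P_{\sigma} ]_{ki}, 0 \right) + \delta_{jL} \sum_{\varepsilon_k \subseteq \varepsilon^c_i} \max\left( [ P_{\sigma} ]_{ki}, 0 \right), & \text{if } \sigma^c_i \le 0, \end{cases} $$ where $\delta_{jK}$ and $\delta_{jL}$ are Kronecker symbols. Then $$ T^{c}_2(\sigma^c, s^c) = D^c\, \mathrm{diag}(\sigma^c)\,U^c(\sigma^c)\, f_w(s^c). $$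
   Context: Fine grid: $\mathcal{T}$ is the finite set of cells of a conforming mesh of a polygonal domain $\Omega\subset\mathbb{R}^3$ and $\mathcal{E}$ is the set of internal faces. Each internal face is shared by exactly two cells and carries a fixed orientation (a unit normal $n_\varepsilon$ pointing from one of its two cells into the other). No-flow conditions hold on $\partial\Omega$, so boundary faces carry no unknowns. A fine flux is a vector $\sigma=(\sigma_j)_{\varepsilon_j\in\mathcal{E}}\in\mathbb{R}^{\mathcal{E}}$, where $\sigma_j$ is the flux through $\varepsilon_j$, positive in the direction of its orientation. A fine saturation is a vector $s\in\mathbb{R}^{\mathcal{T}}$ (one value per cell). Discrete divergence: $D\in\mathbb{R}^{\mathcal{T}\times\mathcal{E}}$ has entry $+1$ at (cell $\tau$, face $\varepsilon$) if $\varepsilon\subset\partial\tau$ and $n_\varepsilon$ points out of $\tau$, $-1$ if $\varepsilon\subset\partial\tau$ and $n_\varepsilon$ points into $\tau$, and $0$ otherwise. Upwind operator: $U(\sigma)\in\mathbb{R}^{\mathcal{E}\times\mathcal{T}}$. For a face $\varepsilon_j$ oriented from cell $\tau_A$ to cell $\tau_B$, row $j$ of $U(\sigma)$ has a single nonzero entry, equal to $1$, located in column $A$ if $\sigma_j>0$ and in column $B$ otherwise. Fractional flow: $f_w(s)=\lambda_w(s)/\lambda(s)$, a real-valued function of a scalar saturation, where $\lambda=\lambda_w+\lambda_{nw}>0$ is the total mobility, the sum of the wetting and non-wetting phase mobilities. For a vector $s$, $f_w(s)$ is applied entrywise. Transport operator: $T_2(\sigma,s):=D\,\mathrm{diag}(\sigma)\,U(\sigma)\,f_w(s)\in\mathbb{R}^{\mathcal{T}}$,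 where $\mathrm{diag}(\sigma)$ is the diagonal matrix with diagonal $\sigma$. Coarse grid: $\mathcal{T}^c$ is a partition of $\mathcal{T}$ into contiguous (connected through internal faces) aggregates, called coarse cells (each identified with the union of its fine cells). For two adjacent coarse cells $\tau^c_K,\tau^c_L$ with $K<L$, the coarse face $\varepsilon^c_{K,L}=\partial\tau^c_K\cap\partial\tau^c_L$ is the union of all fine faces shared by a fine cell of $\tau^c_K$ and a fine cell of $\tau^c_L$; it is oriented from $\tau^c_K$ to $\tau^c_L$. $\mathcal{E}^c$ is the set of coarse faces. Convention: every fine face $\varepsilon_k\subseteq\varepsilon^c_{K,L}$ ($K<L$) is oriented from $\tau^c_K$ to $\tau^c_L$, consistently with the coarse face. Saturation and pressure interpolation/restriction: $P_s=P_p\in\mathbb{R}^{\mathcal{T}\times\mathcal{T}^c}$ has $(i,J)$ entry $1$ if coarse cell $J$ contains fine cell $i$ and $0$ otherwise; $R_s:=P_s^T$, $R_p:=P_p^T$. Flux interpolation: $P_\sigma\in\mathbb{R}^{\mathcal{E}\times\mathcal{E}^c}$ has one column per coarse face. For $\varepsilon^c_i=\varepsilon^c_{K,L}$, column $i$ is obtained from the following local problem, which is the two-point flux discretization on the fine grid of $\mathbb{K}^{-1}\widetilde\phi+\nabla p=0$, $\nabla\cdot\widetilde\phi=q$ in $\tau^c_K\cup\tau^c_L$ with no-flow boundary conditions, where $\mathbb{K}$ is the permeability tensor and $q=1/|\tau^c_K|$ in $\tau^c_K$, $q=-1/|\tau^c_L|$ in $\tau^c_L$. Find $\widetilde\phi\in\mathbb{R}^{\mathcal{E}}$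 and cell pressures $p$ on the fine cells of $\tau^c_K\cup\tau^c_L$ such that: (i) for each fine face $\varepsilon$ oriented from cell $a$ to cell $b$, both contained in $\tau^c_K\cup\tau^c_L$, $\left(\overline\Upsilon_{a,\varepsilon}^{-1}+\overline\Upsilon_{b,\varepsilon}^{-1}\right)\widetilde\phi_\varepsilon-(p_a-p_b)=0$, where $\overline\Upsilon_{a,\varepsilon},\overline\Upsilon_{b,\varepsilon}>0$ are the given one-sided transmissibilities; (ii) $\widetilde\phi_\varepsilon=0$ on all other fine faces; (iii) $(D\widetilde\phi)_a=|\tau_a|/|\tau^c_K|$ for fine cells $\tau_a\subset\tau^c_K$ and $(D\widetilde\phi)_a=-|\tau_a|/|\tau^c_L|$ for fine cells $\tau_a\subset\tau^c_L$, where $|\cdot|$ is volume. Column $i$ of $P_\sigma$ is $\widetilde\phi$ divided by its total flux $\sum_{\varepsilon_k\subseteq\varepsilon^c_i}\widetilde\phi_{k}$ through $\varepsilon^c_i$, so that the total flux of column $i$ through $\varepsilon^c_i$ is $1$. Coarse operators: $D^c:=R_p D P_\sigma$ and $T^c_2(\sigma^c,s^c):=R_s\,T_2(P_\sigma\sigma^c,\,P_s s^c)$ for $\sigma^c\in\mathbb{R}^{\mathcal{E}^c}$, $s^c\in\mathbb{R}^{\mathcal{T}^c}$. *)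

theory Defs
  imports "HOL-Analysis.Analysis" "Jordan_Normal_Form.Matrix"
begin

text \<open>
  Cells, faces, coarse cells and coarse faces are numbered from 0. Vectors and matrices indexed by
  them are those with natural-number dimensions, so that an empty set of (coarse) faces is allowed;
  their \<open>$\<close> replaces the one for \<^typ>\<open>real ^ 3\<close>.
\<close>

unbundle no vec_syntax

type_synonym pt = "real ^ 3"

section \<open>Fine grid\<close>

record fine_grid =
  Omega :: "pt set"
  ncells :: nat
  cell :: "nat \<Rightarrow> pt set"
  nfaces :: nat
  face :: "nat \<Rightarrow> pt set"
  face_normal :: "nat \<Rightarrow> pt"

text \<open>
  Finite unions of polytopes of dimension \<open>d\<close>: for \<open>d = 3\<close> the (not necessarily convex) compact
  polyhedra, for \<open>d = 2\<close> the polygons and polygonal surfaces.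
\<close>
definition polyhedral_set :: "int \<Rightarrow> pt set \<Rightarrow> bool" where
  "polyhedral_set d S \<longleftrightarrow>
     (\<exists>P. finite P \<and> (\<forall>p\<in>P. polytope p \<and> aff_dim p = d) \<and> S = \<Union>P)"

text \<open>
  \<open>points_into n e t\<close>: starting at a point of the flat face \<open>e\<close> off its edges, small steps in
  direction \<open>n\<close> lead into the interior of \<open>t\<close>. Used only for \<open>e\<close> on the boundary of \<open>t\<close>.
\<close>
definition points_into :: "pt \<Rightarrow> pt set \<Rightarrow> pt set \<Rightarrow> bool" where
  "points_into n e t \<longleftrightarrow>
     (\<forall>x\<in>rel_interior e. \<forall>\<^sub>F h in at_right 0. x + h *\<^sub>R n \<in> interior t)"

definition points_out_of :: "pt \<Rightarrow> pt set \<Rightarrow> pt set \<Rightarrow> bool" where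
  "points_out_of n e t \<longleftrightarrow> points_into (- n) e t"

definition on_boundary :: "('z) fine_grid_scheme \<Rightarrow> nat \<Rightarrow> nat \<Rightarrow> bool" where
  "on_boundary G j a \<longleftrightarrow> face G j \<subseteq> frontier (cell G a)"

definition oriented_from_to :: "('z) fine_grid_scheme \<Rightarrow> nat \<Rightarrow> nat \<Rightarrow> nat \<Rightarrow> bool" where
  "oriented_from_to G j a b \<longleftrightarrow>
     on_boundary G j a \<and> points_out_of (face_normal G j) (face G j) (cell G a) \<and>
     on_boundary G j b \<and> points_into (face_normal G j) (face G j) (cell G b)"

text \<open>
  The numbered faces are the internal ones. In the last condition, every part of the boundary
  of a cell that lies in the open domain is covered by internal faces of that cell; since each
  of these is a full face of the two cells sharing it, this is conformity.
\<close>
definition fine_mesh :: "('z) fine_grid_scheme \<Rightarrow> bool" where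
  "fine_mesh G \<longleftrightarrow>
     open (Omega G) \<and> connected (Omega G) \<and> Omega G \<noteq> {} \<and> bounded (Omega G) \<and>
     polyhedral_set 2 (frontier (Omega G)) \<and>
     (\<Union>a<ncells G. cell G a) = closure (Omega G) \<and>
     (\<forall>a<ncells G. polyhedral_set 3 (cell G a) \<and> cell G a \<noteq> {}) \<and>
     (\<forall>a<ncells G. \<forall>b<ncells G. a \<noteq> b \<longrightarrow> interior (cell G a) \<inter> interior (cell G b) = {}) \<and>
     (\<forall>j<nfaces G. polyhedral_set 2 (face G j) \<and> aff_dim (face G j) = 2 \<and>
        rel_interior (face G j) \<subseteq> Omega G) \<and>
     (\<forall>j<nfaces G. \<forall>k<nfaces G. j \<noteq> k \<longrightarrow> rel_interior (face G j) \<inter> face G k = {}) \<and>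
     (\<forall>j<nfaces G. norm (face_normal G j) = 1 \<and>
        (\<forall>x\<in>face G j. \<forall>y\<in>face G j. inner (face_normal G j) (x - y) = 0)) \<and>
     (\<forall>j<nfaces G. \<exists>a<ncells G. \<exists>b<ncells G. a \<noteq> b \<and>
        {c. c < ncells G \<and> on_boundary G j c} = {a, b} \<and> oriented_from_to G j a b) \<and>
     (\<forall>a<ncells G. frontier (cell G a) \<inter> Omega G
        \<subseteq> (\<Union>j\<in>{j. j < nfaces G \<and> on_boundary G j a}. face G j))"

definition div_mat :: "('z) fine_grid_scheme \<Rightarrow> real mat" where
  "div_mat G = mat (ncells G) (nfaces G) (\<lambda>(a, j).
     if on_boundary G j a \<and> points_out_of (face_normal G j) (face G j) (cell G a) then 1
     else if on_boundary G j a \<and> points_into (face_normal G j) (face G j) (cell G a) then - 1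
     else 0)"

definition upwind_mat :: "('z) fine_grid_scheme \<Rightarrow> real vec \<Rightarrow> real mat" where
  "upwind_mat G \<sigma> = mat (nfaces G) (ncells G) (\<lambda>(j, c).
     if \<exists>a<ncells G. \<exists>b<ncells G. oriented_from_to G j a b \<and> c = (if \<sigma> $ j > 0 then a else b)
     then 1 else 0)"

definition frac_flow :: "(real \<Rightarrow> real) \<Rightarrow> (real \<Rightarrow> real) \<Rightarrow> real \<Rightarrow> real" where
  "frac_flow lam_w lam_nw s = lam_w s / (lam_w s + lam_nw s)"

definition diag_of_vec :: "real vec \<Rightarrow> real mat" where
  "diag_of_vec v = mat_diag (dim_vec v) (\<lambda>i. v $ i)"

definition transport ::
    "('z) fine_grid_scheme \<Rightarrow> (real \<Rightarrow> real) \<Rightarrow> real vec \<Rightarrow> real vec \<Rightarrow> real vec" where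
  "transport G fw \<sigma> s = (div_mat G * diag_of_vec \<sigma> * upwind_mat G \<sigma>) *\<^sub>v map_vec fw s"

section \<open>Coarse grid\<close>

text \<open>
  \<open>agg K\<close> is the set of (numbers of) fine cells of the coarse cell \<open>K\<close>, and \<open>cface i = (K, L)\<close>
  with \<open>K < L\<close> says that the coarse face number \<open>i\<close> is the one between the coarse cells \<open>K\<close> and
  \<open>L\<close>.
\<close>
record two_level_grid = fine_grid +
  naggs :: nat
  agg :: "nat \<Rightarrow> nat set"
  ncfaces :: nat
  cface :: "nat \<Rightarrow> nat \<times> nat"

definition coarse_cell :: "two_level_grid \<Rightarrow> nat \<Rightarrow> pt set" where
  "coarse_cell G K = (\<Union>a\<in>agg G K. cell G a)"

text \<open>A coarse face is represented by the set of (numbers of) fine faces it consists of.\<close>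
definition coarse_face :: "two_level_grid \<Rightarrow> nat \<Rightarrow> nat \<Rightarrow> nat set" where
  "coarse_face G K L =
     {k. k < nfaces G \<and> (\<exists>a\<in>agg G K. \<exists>b\<in>agg G L. on_boundary G k a \<and> on_boundary G k b)}"

definition contiguous :: "('z) fine_grid_scheme \<Rightarrow> nat set \<Rightarrow> bool" where
  "contiguous G A \<longleftrightarrow>
     (\<forall>a\<in>A. \<forall>b\<in>A. (a, b) \<in> {(x, y). x \<in> A \<and> y \<in> A \<and>
        (\<exists>j<nfaces G. on_boundary G j x \<and> on_boundary G j y)}\<^sup>*)"

definition two_level_mesh :: "two_level_grid \<Rightarrow> bool" where
  "two_level_mesh G \<longleftrightarrow>
     fine_mesh G \<and>
     (\<Union>K<naggs G. agg G K) = {..<ncells G} \<and>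
     (\<forall>K<naggs G. agg G K \<noteq> {} \<and> contiguous G (agg G K)) \<and>
     (\<forall>K<naggs G. \<forall>L<naggs G. K \<noteq> L \<longrightarrow> agg G K \<inter> agg G L = {}) \<and>
     bij_betw (cface G) {..<ncfaces G}
       {(K, L). K < L \<and> L < naggs G \<and> coarse_face G K L \<noteq> {}} \<and>
     (\<forall>K L. K < L \<and> L < naggs G \<longrightarrow>
        (\<forall>k\<in>coarse_face G K L. \<exists>a\<in>agg G K. \<exists>b\<in>agg G L. oriented_from_to G k a b))"

definition interp_s :: "two_level_grid \<Rightarrow> real mat" where
  "interp_s G = mat (ncells G) (naggs G) (\<lambda>(i, J). if i \<in> agg G J then 1 else 0)"

abbreviation interp_p :: "two_level_grid \<Rightarrow> real mat" where
  "interp_p \<equiv> interp_s"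

abbreviation restrict_s :: "two_level_grid \<Rightarrow> real mat" where
  "restrict_s G \<equiv> transpose_mat (interp_s G)"

abbreviation restrict_p :: "two_level_grid \<Rightarrow> real mat" where
  "restrict_p G \<equiv> transpose_mat (interp_p G)"

text \<open>
  \<open>Ups a j\<close> is the one-sided transmissibility of the face \<open>j\<close> seen from the cell \<open>a\<close>; only its
  values for faces \<open>j\<close> on the boundary of \<open>a\<close> matter. Likewise only the values of the pressure
  \<open>p\<close> on the two aggregates matter.
\<close>
definition local_solution ::
    "two_level_grid \<Rightarrow> (nat \<Rightarrow> nat \<Rightarrow> real) \<Rightarrow> nat \<Rightarrow> nat \<Rightarrow> real vec \<Rightarrow> (nat \<Rightarrow> real) \<Rightarrow> bool" where
  "local_solution G Ups K L \<phi> p \<longleftrightarrow>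
     \<phi> \<in> carrier_vec (nfaces G) \<and>
     (\<forall>j<nfaces G. \<forall>a\<in>agg G K \<union> agg G L. \<forall>b\<in>agg G K \<union> agg G L. oriented_from_to G j a b \<longrightarrow>
        (inverse (Ups a j) + inverse (Ups b j)) * \<phi> $ j - (p a - p b) = 0) \<and>
     (\<forall>j<nfaces G.
        \<not> (\<exists>a\<in>agg G K \<union> agg G L. \<exists>b\<in>agg G K \<union> agg G L. oriented_from_to G j a b) \<longrightarrow>
        \<phi> $ j = 0) \<and>
     (\<forall>a\<in>agg G K. (div_mat G *\<^sub>v \<phi>) $ a =
        measure lebesgue (cell G a) / measure lebesgue (coarse_cell G K)) \<and>
     (\<forall>a\<in>agg G L. (div_mat G *\<^sub>v \<phi>) $ a =
        - (measure lebesgue (cell G a) / measure lebesgue (coarse_cell G L)))"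

text \<open>
  For adjacent contiguous aggregates the local problem is solvable (the prescribed divergences
  add up to zero) and determines the flux uniquely, and the pressure up to a constant.
\<close>
definition local_flux ::
    "two_level_grid \<Rightarrow> (nat \<Rightarrow> nat \<Rightarrow> real) \<Rightarrow> nat \<Rightarrow> nat \<Rightarrow> real vec" where
  "local_flux G Ups K L = (SOME \<phi>. \<exists>p. local_solution G Ups K L \<phi> p)"

definition interp_flux :: "two_level_grid \<Rightarrow> (nat \<Rightarrow> nat \<Rightarrow> real) \<Rightarrow> real mat" where
  "interp_flux G Ups = mat (nfaces G) (ncfaces G) (\<lambda>(k, i).
     let (K, L) = cface G i; \<phi> = local_flux G Ups K L
     in \<phi> $ k / (\<Sum>l\<in>coarse_face G K L. \<phi> $ l))"

definition coarse_div :: "two_level_grid \<Rightarrow> (nat \<Rightarrow> nat \<Rightarrow> real) \<Rightarrow> real mat" where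
  "coarse_div G Ups = restrict_p G * div_mat G * interp_flux G Ups"

definition coarse_transport ::
    "two_level_grid \<Rightarrow> (nat \<Rightarrow> nat \<Rightarrow> real) \<Rightarrow> (real \<Rightarrow> real) \<Rightarrow> real vec \<Rightarrow> real vec \<Rightarrow> real vec" where
  "coarse_transport G Ups fw \<sigma>c sc =
     restrict_s G *\<^sub>v transport G fw (interp_flux G Ups *\<^sub>v \<sigma>c) (interp_s G *\<^sub>v sc)"

definition coarse_upwind ::
    "two_level_grid \<Rightarrow> (nat \<Rightarrow> nat \<Rightarrow> real) \<Rightarrow> real vec \<Rightarrow> real mat" where
  "coarse_upwind G Ups \<sigma>c = mat (ncfaces G) (naggs G) (\<lambda>(i, j).
     let (K, L) = cface G i;
         pos = (\<Sum>k\<in>coarse_face G K L. max (interp_flux G Ups $$ (k, i)) 0);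
         neg = (\<Sum>k\<in>coarse_face G K L. min (interp_flux G Ups $$ (k, i)) 0)
     in if \<sigma>c $ i > 0
        then of_bool (j = K) * pos + of_bool (j = L) * neg
        else of_bool (j = K) * neg + of_bool (j = L) * pos)"

end

(*
  Entry J of R_s T_2 sums the fine upwind fluxes over the faces with exactly one of their two
  cells in the aggregate J, since the two contributions of a face inside an aggregate cancel. Such a
  face k lies on a single coarse face i between aggregates K < L. The columns of P_sigma vanish
  on all faces that leave the two aggregates of their local problem, so only column i contributes
  to the flux through k, which is therefore P_ki * sigma_i; its sign decides between K and L, and
  splitting P_ki into max (P_ki, 0) and min (P_ki, 0) gives row i of the coarse upwind matrix.
  Summed over the faces, column i of P_sigma gives 1, so that D^c has the entries 1 and -1.

  As the local flux is an arbitrary choice if the local problem has no solution, solvability has to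
  be proved. The problem is a weighted graph Laplacian on a connected graph, so it is solvable for
  right-hand sides with sum 0; that the prescribed divergences add up to zero is the additivity of
  volume over cells with disjoint interiors.
*)
theory Submission
  imports Defs "Jordan_Normal_Form.Determinant"
begin

section \<open>Matrices\<close>

lemma mat_vec_index:
  fixes A :: "real mat"
  assumes "A \<in> carrier_mat n m" "v \<in> carrier_vec m" "i < n"
  shows "(A *\<^sub>v v) $ i = (\<Sum>j<m. A $$ (i, j) * v $ j)"
  using assms by (simp add: scalar_prod_def atLeast0LessThan)

lemma mat_mult_index:
  fixes A :: "real mat"
  assumes "A \<in> carrier_mat n m" "B \<in> carrier_mat m l" "i < n" "k < l"
  shows "(A * B) $$ (i, k) = (\<Sum>j<m. A $$ (i, j) * B $$ (j, k))"
  using assms by (simp add: scalar_prod_def atLeast0LessThan)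

lemma diag_of_vec_mult:
  assumes "v \<in> carrier_vec n" "x \<in> carrier_vec n"
  shows "diag_of_vec v *\<^sub>v x = vec n (\<lambda>i. v $ i * x $ i)"
proof (rule eq_vecI)
  fix i assume i: "i < dim_vec (vec n (\<lambda>i. v $ i * x $ i))"
  have "(diag_of_vec v *\<^sub>v x) $ i = (\<Sum>j<n. diag_of_vec v $$ (i, j) * x $ j)"
    using assms i by (intro mat_vec_index[where n = n]) (auto simp: diag_of_vec_def)
  also have "\<dots> = (\<Sum>j<n. if j = i then v $ i * x $ i else 0)"
    using assms i by (intro sum.cong) (auto simp: diag_of_vec_def mat_diag_def)
  finally show "(diag_of_vec v *\<^sub>v x) $ i = vec n (\<lambda>i. v $ i * x $ i) $ i"
    using i by simp
qed (use assms in \<open>simp add: diag_of_vec_def mat_diag_def\<close>)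

lemma mult3_mat_vec:
  fixes A :: "real mat"
  assumes "A \<in> carrier_mat n m" "B \<in> carrier_mat m l" "C \<in> carrier_mat l k" "v \<in> carrier_vec k"
  shows "(A * B * C) *\<^sub>v v = A *\<^sub>v (B *\<^sub>v (C *\<^sub>v v))"
  using assoc_mult_mat_vec[OF mult_carrier_mat[OF assms(1,2)] assms(3,4)]
    assoc_mult_mat_vec[OF assms(1,2) mult_mat_vec_carrier[OF assms(3,4)]] by simp

section \<open>Weighted graph Laplacians\<close>

text \<open>Injectivity of a square matrix makes its determinant nonzero, which provides a right
  inverse. The numbering \<open>e\<close> carries this over to an arbitrary finite index
  set.\<close>

lemma finite_system_solvable:
  fixes A :: "'a \<Rightarrow> 'a \<Rightarrow> real"
  assumes fin: "finite V"
    and inj: "\<And>x. (\<And>a. a \<in> V \<Longrightarrow> (\<Sum>b\<in>V. A a b * x b) = 0) \<Longrightarrow> \<forall>a\<in>V. x a = 0"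
  obtains x where "\<And>a. a \<in> V \<Longrightarrow> (\<Sum>b\<in>V. A a b * x b) = r a"
proof -
  define n where "n = card V"
  obtain e where e: "bij_betw e {0..<n} V"
    using ex_bij_betw_nat_finite[OF fin] n_def by blast
  define M where "M = mat n n (\<lambda>(i, j). A (e i) (e j))"
  have M: "M \<in> carrier_mat n n" by (simp add: M_def)
  define f where "f = inv_into {0..<n} e"
  have f: "f a < n" "e (f a) = a" if "a \<in> V" for a
    using e that unfolding f_def
    by (metis bij_betw_imp_surj_on inv_into_into atLeastLessThan_iff, metis bij_betw_inv_into_right)
  have fe: "f (e i) = i" if "i < n" for i
    using bij_betw_inv_into_left[OF e] that by (simp add: f_def)
  have row: "(M *\<^sub>v v) $ f a = (\<Sum>b\<in>V. A a b * v $ f b)"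
    if "v \<in> carrier_vec n" "a \<in> V" for v a
  proof -
    have "(M *\<^sub>v v) $ f a = (\<Sum>j\<in>{0..<n}. A a (e j) * v $ j)"
      using that f by (simp add: M_def scalar_prod_def)
    also have "\<dots> = (\<Sum>j\<in>{0..<n}. A a (e j) * v $ f (e j))"
      by (intro sum.cong) (auto simp: fe)
    also have "\<dots> = (\<Sum>b\<in>V. A a b * v $ f b)"
      using e by (rule sum.reindex_bij_betw)
    finally show ?thesis .
  qed
  have "det M \<noteq> 0"
  proof
    assume "det M = 0"
    then obtain v where v: "v \<in> carrier_vec n" "v \<noteq> 0\<^sub>v n" "M *\<^sub>v v = 0\<^sub>v n"
      using det_0_iff_vec_prod_zero_field[OF M] by blast
    have "\<forall>a\<in>V. v $ f a = 0"
      by (rule inj) (use row v f in \<open>metis index_zero_vec(1)\<close>)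
    then have "v $ i = 0" if "i < n" for i
      using e fe that by (metis atLeastLessThan_iff bij_betwE le0)
    with v show False by (auto intro: eq_vecI)
  qed
  then obtain B where B: "B \<in> carrier_mat n n" "M * B = 1\<^sub>m n"
    using det_non_zero_imp_unit[OF M] by (auto simp: Units_def ring_mat_simps)
  define v where "v = B *\<^sub>v vec n (\<lambda>i. r (e i))"
  have v: "v \<in> carrier_vec n" using B by (simp add: v_def)
  have "M *\<^sub>v v = vec n (\<lambda>i. r (e i))"
    unfolding v_def using M B
    by (metis assoc_mult_mat_vec one_mult_mat_vec vec_carrier)
  then have "(\<Sum>b\<in>V. A a b * v $ f b) = r a" if "a \<in> V" for a
    using row[OF v that] f[OF that] by simp
  then show ?thesis by (rule that)
qed

text \<open>Signed vertex-edge incidence matrix of a directed graph with tails \<open>t\<close> and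
  heads \<open>h\<close>. The sign is that of the discrete divergence: positive at the cell that the
  face leaves.\<close>

definition incidence :: "('e \<Rightarrow> 'v) \<Rightarrow> ('e \<Rightarrow> 'v) \<Rightarrow> 'v \<Rightarrow> 'e \<Rightarrow> real" where
  "incidence t h a j = of_bool (a = t j) - of_bool (a = h j)"

text \<open>The transposed incidence matrix takes differences along edges. It serves for pressures
  and, with \<open>p\<close> the indicator of an aggregate, for the restricted divergence.\<close>

lemma sum_incidence_mult:
  assumes "finite V" "t j \<in> V" "h j \<in> V"
  shows "(\<Sum>a\<in>V. incidence t h a j * p a) = p (t j) - p (h j)"
proof -
  have delta: "of_bool (a = c) * p a = (if a = c then p a else 0)" for a c
    by simp
  show ?thesis
    using assms by (simp add: incidence_def left_diff_distrib sum_subtractf delta)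
qed

text \<open>Vanishing Dirichlet energy makes a potential agree across every edge, so only constants
  lie in the kernel of the Laplacian. Connectedness is phrased through potentials because that is
  what the energy argument can use directly.\<close>

lemma graph_laplacian_solvable:
  fixes w :: "'e \<Rightarrow> real" and r :: "'v \<Rightarrow> real"
  assumes V: "finite V" "V \<noteq> {}"
    and ends: "\<And>j. j \<in> E \<Longrightarrow> t j \<in> V" "\<And>j. j \<in> E \<Longrightarrow> h j \<in> V"
    and E: "finite E" and w: "\<And>j. j \<in> E \<Longrightarrow> w j > 0"
    and connected: "\<And>(p :: 'v \<Rightarrow> real) a b. (\<And>j. j \<in> E \<Longrightarrow> p (t j) = p (h j)) \<Longrightarrow>
        a \<in> V \<Longrightarrow> b \<in> V \<Longrightarrow> p a = p b"
    and balance: "(\<Sum>a\<in>V. r a) = 0"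
  obtains p where "\<And>a. a \<in> V \<Longrightarrow> (\<Sum>j\<in>E. incidence t h a j * (w j * (p (t j) - p (h j)))) = r a"
proof -
  let ?I = "incidence t h"
  \<comment> \<open>Adding the all-ones matrix to the Laplacian makes it injective; for a balanced right-hand
    side the added term vanishes on the solution.\<close>
  define A where "A a b = 1 + (\<Sum>j\<in>E. w j * ?I a j * ?I b j)" for a b
  have A: "(\<Sum>b\<in>V. A a b * x b) =
      (\<Sum>b\<in>V. x b) + (\<Sum>j\<in>E. ?I a j * (w j * (x (t j) - x (h j))))" for a x
  proof -
    have "(\<Sum>b\<in>V. A a b * x b) = (\<Sum>b\<in>V. x b) + (\<Sum>b\<in>V. \<Sum>j\<in>E. w j * ?I a j * (?I b j * x b))"
      by (simp add: A_def distrib_right sum.distrib sum_distrib_right mult.assoc)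
    also have "(\<Sum>b\<in>V. \<Sum>j\<in>E. w j * ?I a j * (?I b j * x b)) =
        (\<Sum>j\<in>E. w j * ?I a j * (\<Sum>b\<in>V. ?I b j * x b))"
      by (subst sum.swap) (simp add: sum_distrib_left)
    also have "\<dots> = (\<Sum>j\<in>E. ?I a j * (w j * (x (t j) - x (h j))))"
      using V ends by (intro sum.cong) (simp_all add: sum_incidence_mult)
    finally show ?thesis .
  qed
  \<comment> \<open>Summation by parts. With \<open>x = y\<close> it gives the Dirichlet energy;
    with \<open>x\<close> constantly 1 it shows that the Laplacian of any potential sums to
    zero.\<close>
  have weak: "(\<Sum>a\<in>V. x a * (\<Sum>j\<in>E. ?I a j * (w j * (y (t j) - y (h j))))) =
      (\<Sum>j\<in>E. w j * (y (t j) - y (h j)) * (x (t j) - x (h j)))" for x y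
  proof -
    have "(\<Sum>a\<in>V. x a * (\<Sum>j\<in>E. ?I a j * (w j * (y (t j) - y (h j))))) =
      (\<Sum>j\<in>E. w j * (y (t j) - y (h j)) * (\<Sum>a\<in>V. ?I a j * x a))"
      by (simp add: sum_distrib_left) (subst sum.swap, simp add: algebra_simps)
    also have "\<dots> = (\<Sum>j\<in>E. w j * (y (t j) - y (h j)) * (x (t j) - x (h j)))"
      using V ends by (intro sum.cong) (simp_all add: sum_incidence_mult)
    finally show ?thesis .
  qed
  obtain p where p: "\<And>a. a \<in> V \<Longrightarrow> (\<Sum>b\<in>V. A a b * p b) = r a"
  proof (rule finite_system_solvable[OF V(1), where A = A and r = r])
    fix x assume x0: "\<And>a. a \<in> V \<Longrightarrow> (\<Sum>b\<in>V. A a b * x b) = 0"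
    \<comment> \<open>Testing with \<open>x\<close> itself leaves two nonnegative terms, so the
      total of \<open>x\<close> and its energy both vanish.\<close>
    have "0 = (\<Sum>a\<in>V. x a * (\<Sum>b\<in>V. A a b * x b))" using x0 by simp
    also have "\<dots> = (\<Sum>b\<in>V. x b)\<^sup>2 + (\<Sum>j\<in>E. w j * (x (t j) - x (h j))\<^sup>2)"
      unfolding A distrib_left sum.distrib weak
      by (simp add: sum_distrib_right[symmetric] power2_eq_square mult.assoc)
    finally have eq: "(\<Sum>b\<in>V. x b)\<^sup>2 + (\<Sum>j\<in>E. w j * (x (t j) - x (h j))\<^sup>2) = 0" by simp
    have nn: "0 \<le> w j * (x (t j) - x (h j))\<^sup>2" if "j \<in> E" for j using w[OF that] by simp
    have sq: "(\<Sum>b\<in>V. x b) = 0" "(\<Sum>j\<in>E. w j * (x (t j) - x (h j))\<^sup>2) = 0"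
      using eq sum_nonneg[OF nn, of E "\<lambda>j. j"] by (auto simp: add_nonneg_eq_0_iff)
    have "x (t j) = x (h j)" if "j \<in> E" for j
      using sq(2) nn w that sum_nonneg_eq_0_iff[OF E nn] by fastforce
    then have const: "x a = x b" if "a \<in> V" "b \<in> V" for a b using connected that by blast
    show "\<forall>a\<in>V. x a = 0"
    proof
      fix a assume a: "a \<in> V"
      have "(\<Sum>b\<in>V. x b) = (\<Sum>b\<in>V. x a)" by (intro sum.cong refl const[OF _ a])
      with sq(1) have "card V * x a = 0" by simp
      with V show "x a = 0" by simp
    qed
  qed blast
  have "0 = (\<Sum>a\<in>V. 1 * (\<Sum>b\<in>V. A a b * p b))" using p balance by simp
  also have "\<dots> = card V * (\<Sum>b\<in>V. p b)"
    unfolding A distrib_left sum.distrib weak[of "\<lambda>_. 1"] by simp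
  finally have "(\<Sum>b\<in>V. p b) = 0" using V by simp
  then show ?thesis using p unfolding A by (intro that[of p]) simp
qed

section \<open>Geometry of the mesh\<close>

text \<open>The frontier of a finite union lies in the union of the frontiers, and convex sets have
  negligible frontiers.\<close>

lemma polyhedral_set_negligible_frontier:
  assumes "polyhedral_set d S"
  shows "negligible (frontier S)" "S \<in> lmeasurable"
proof -
  obtain P where P: "finite P" "\<And>p. p \<in> P \<Longrightarrow> polytope p" "S = \<Union>P"
    using assms by (auto simp: polyhedral_set_def)
  have "frontier S \<subseteq> (\<Union>p\<in>P. frontier p)"
    using frontier_Union_subset[of P] P by simp
  moreover have "negligible (\<Union>p\<in>P. frontier p)"
    using P by (auto intro!: negligible_Union negligible_convex_frontier polytope_imp_convex)
  ultimately show "negligible (frontier S)" by (rule negligible_subset[rotated])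
  show "S \<in> lmeasurable"
    unfolding P(3) using P(1,2)
    by (auto intro: fmeasurable.finite_Union lmeasurable_compact polytope_imp_compact)
qed

text \<open>A polytope of full dimension 3 has nonempty interior, and a nonempty open set is not
  negligible.\<close>

lemma polyhedral_set_measure_pos:
  assumes "polyhedral_set 3 S" "S \<noteq> {}"
  shows "measure lebesgue S > 0"
proof -
  obtain P where P: "\<And>p. p \<in> P \<Longrightarrow> polytope p \<and> aff_dim p = 3" "S = \<Union>P"
    using assms(1) by (auto simp: polyhedral_set_def)
  with assms(2) obtain p where p: "p \<in> P" by auto
  have "interior p \<noteq> {}"
    using P(1)[OF p] interior_rel_interior_gen[of p] rel_interior_eq_empty[of p] aff_dim_empty[of p]
    by (force dest: polytope_imp_convex)
  moreover have "interior p \<subseteq> S" using p P(2) interior_subset by blast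
  ultimately have "\<not> negligible S"
    by (meson negligible_subset open_interior open_not_negligible)
  with polyhedral_set_negligible_frontier(2)[OF assms(1)] show ?thesis
    using negligible_iff_measure0 zero_less_measure_iff by (metis measure_nonneg order_less_le)
qed

text \<open>Equal dimensions give any polytope of the union the affine hull of \<open>S\<close>; its
  relative interior, nonempty by convexity, then lies in that of \<open>S\<close>.\<close>

lemma polyhedral_set_rel_interior_nonempty:
  assumes "polyhedral_set d S" "aff_dim S = d" "d \<ge> 0"
  shows "rel_interior S \<noteq> {}"
proof -
  obtain P where P: "\<And>p. p \<in> P \<Longrightarrow> polytope p \<and> aff_dim p = d" "S = \<Union>P"
    using assms(1) by (auto simp: polyhedral_set_def)
  moreover have "S \<noteq> {}" using assms(2,3) by auto
  ultimately obtain p where p: "p \<in> P" by auto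
  then have "p \<subseteq> S" and pp: "polytope p" "aff_dim p = d" using P by auto
  then have "affine hull p = affine hull S"
    using aff_dim_eq_full_gen assms(2) by (metis order_refl)
  then have "rel_interior p \<subseteq> rel_interior S"
    by (rule rel_interior_mono[OF \<open>p \<subseteq> S\<close>])
  moreover have "rel_interior p \<noteq> {}"
    using pp assms(3) rel_interior_eq_empty[of p] by (auto dest: polytope_imp_convex)
  ultimately show ?thesis by blast
qed

text \<open>Small enough steps from one point of the face end in both interiors. As cells have
  disjoint interiors, each side of a face belongs to at most one cell.\<close>

lemma points_into_unique:
  assumes "rel_interior e \<noteq> {}" "points_into n e s" "points_into n e t"
  shows "interior s \<inter> interior t \<noteq> {}"
proof -
  obtain x where x: "x \<in> rel_interior e" using assms(1) by blast
  have "\<forall>\<^sub>F h :: real in at_right 0. x + h *\<^sub>R n \<in> interior s \<inter> interior t"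
    using assms(2,3) x by (auto simp: points_into_def intro: eventually_conj)
  then show ?thesis
    using eventually_happens trivial_limit_at_right_real by fastforce
qed

text \<open>The normal leaves exactly one cell and enters exactly one, so the geometric conditions
  in \<open>oriented_from_to\<close> and \<open>div_mat\<close> become equations between cell
  numbers.\<close>

lemma fine_mesh_face_ends:
  assumes mesh: "fine_mesh G" and j: "j < nfaces G"
  obtains a b where "a < ncells G" "b < ncells G" "a \<noteq> b"
    "\<And>c. c < ncells G \<Longrightarrow> on_boundary G j c \<longleftrightarrow> c = a \<or> c = b"
    "\<And>c d. c < ncells G \<Longrightarrow> d < ncells G \<Longrightarrow> oriented_from_to G j c d \<longleftrightarrow> c = a \<and> d = b"
    "\<And>c. c < ncells G \<Longrightarrow> div_mat G $$ (c, j) = of_bool (c = a) - of_bool (c = b)"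
proof -
  obtain a b where ab: "a < ncells G" "b < ncells G" "a \<noteq> b"
    "{c. c < ncells G \<and> on_boundary G j c} = {a, b}" "oriented_from_to G j a b"
    using mesh j unfolding fine_mesh_def by metis
  have ri: "rel_interior (face G j) \<noteq> {}"
    using mesh j by (intro polyhedral_set_rel_interior_nonempty[of 2]) (auto simp: fine_mesh_def)
  have disj: "interior (cell G c) \<inter> interior (cell G d) = {}"
    if "c < ncells G" "d < ncells G" "c \<noteq> d" for c d
    using mesh that by (simp add: fine_mesh_def)
  \<comment> \<open>Stated for any direction \<open>v\<close>, because \<open>points_out_of\<close>
    is \<open>points_into\<close> for the reversed normal.\<close>
  have uniq: "c = d" if "c < ncells G" "d < ncells G"
    "points_into v (face G j) (cell G c)" "points_into v (face G j) (cell G d)" for v c d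
    using points_into_unique[OF ri] disj that by blast
  have bd: "on_boundary G j c \<longleftrightarrow> c = a \<or> c = b" if "c < ncells G" for c
    using ab(4) that by blast
  have out: "points_out_of (face_normal G j) (face G j) (cell G c) \<longleftrightarrow> c = a"
    and into: "points_into (face_normal G j) (face G j) (cell G c) \<longleftrightarrow> c = b"
    if "c < ncells G" for c
    using uniq ab that unfolding oriented_from_to_def points_out_of_def by blast+
  show ?thesis
  proof (rule that[OF ab(1-3) bd])
    show "oriented_from_to G j c d \<longleftrightarrow> c = a \<and> d = b" if "c < ncells G" "d < ncells G" for c d
      using bd out into that unfolding oriented_from_to_def by blast
    show "div_mat G $$ (c, j) = of_bool (c = a) - of_bool (c = b)" if "c < ncells G" for c
      using bd out into that j ab(3) by (auto simp: div_mat_def)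
  qed
qed

text \<open>A point common to two cells lies on the frontier of one of them, and frontiers are
  negligible. Additivity balances the local problem; positivity makes its quotients by coarse
  volumes meaningful.\<close>

lemma measure_coarse_cell:
  assumes mesh: "two_level_mesh G" and K: "K < naggs G"
  shows "measure lebesgue (coarse_cell G K) = (\<Sum>a\<in>agg G K. measure lebesgue (cell G a))"
    and "measure lebesgue (coarse_cell G K) > 0"
proof -
  have fine: "fine_mesh G" using mesh by (simp add: two_level_mesh_def)
  have sub: "agg G K \<subseteq> {..<ncells G}" and ne: "agg G K \<noteq> {}"
    using mesh K by (auto simp: two_level_mesh_def)
  have fin: "finite (agg G K)" using sub finite_subset by blast
  have cells: "polyhedral_set 3 (cell G a)" "cell G a \<noteq> {}" if "a \<in> agg G K" for a
    using fine sub that by (simp_all add: fine_mesh_def subset_iff)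
  have neg: "negligible (cell G a \<inter> cell G b)" if "a \<in> agg G K" "b \<in> agg G K" "a \<noteq> b" for a b
  proof (rule negligible_subset)
    show "negligible (frontier (cell G a) \<union> frontier (cell G b))"
      using polyhedral_set_negligible_frontier(1)[OF cells(1)] that by simp
    have "interior (cell G a) \<inter> interior (cell G b) = {}"
      using fine sub that by (simp add: fine_mesh_def subset_iff)
    then show "cell G a \<inter> cell G b \<subseteq> frontier (cell G a) \<union> frontier (cell G b)"
      using closure_subset unfolding frontier_def by blast
  qed
  show sum: "measure lebesgue (coarse_cell G K) = (\<Sum>a\<in>agg G K. measure lebesgue (cell G a))"
    unfolding coarse_cell_def
    by (rule measure_negligible_finite_Union_image[OF fin])
      (use polyhedral_set_negligible_frontier(2)[OF cells(1)] neg in \<open>auto simp: pairwise_def\<close>)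
  show "measure lebesgue (coarse_cell G K) > 0"
    unfolding sum using fin ne cells by (intro sum_pos polyhedral_set_measure_pos) auto
qed

section \<open>Two-level grids\<close>

text \<open>Induction along a chain of neighbouring cells turns contiguity into the form of
  connectedness used for the Laplacian.\<close>

lemma contiguous_imp_constant:
  assumes "contiguous G A" "a \<in> A" "b \<in> A"
    and "\<And>j x y. j < nfaces G \<Longrightarrow> x \<in> A \<Longrightarrow> y \<in> A \<Longrightarrow>
      on_boundary G j x \<Longrightarrow> on_boundary G j y \<Longrightarrow> p x = p y"
  shows "p a = p b"
proof -
  have "(a, b) \<in> {(x, y). x \<in> A \<and> y \<in> A \<and>
      (\<exists>j<nfaces G. on_boundary G j x \<and> on_boundary G j y)}\<^sup>*"
    using assms(1-3) unfolding contiguous_def by blast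
  then show ?thesis
    by (induction rule: rtrancl_induct) (use assms(4) in auto)
qed

text \<open>The combinatorics of the mesh: face \<open>j\<close> leaves cell \<open>t j\<close> and
  enters cell \<open>h j\<close>, and \<open>part c\<close> is the aggregate of cell
  \<open>c\<close>.\<close>

locale two_level_topology =
  fixes G :: two_level_grid and t h part :: "nat \<Rightarrow> nat"
  assumes mesh: "two_level_mesh G"
    and ends: "\<And>j. j < nfaces G \<Longrightarrow> t j < ncells G" "\<And>j. j < nfaces G \<Longrightarrow> h j < ncells G"
    and on_boundary_iff: "\<And>j c. j < nfaces G \<Longrightarrow> c < ncells G \<Longrightarrow>
      on_boundary G j c \<longleftrightarrow> c = t j \<or> c = h j"
    and oriented_iff: "\<And>j c d. j < nfaces G \<Longrightarrow> c < ncells G \<Longrightarrow> d < ncells G \<Longrightarrow>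
      oriented_from_to G j c d \<longleftrightarrow> c = t j \<and> d = h j"
    and div_mat_index: "\<And>j c. j < nfaces G \<Longrightarrow> c < ncells G \<Longrightarrow>
      div_mat G $$ (c, j) = incidence t h c j"
    and part_less: "\<And>c. c < ncells G \<Longrightarrow> part c < naggs G"
    and agg_iff: "\<And>K c. K < naggs G \<Longrightarrow> c \<in> agg G K \<longleftrightarrow> c < ncells G \<and> part c = K"

lemma two_level_mesh_topology:
  assumes "two_level_mesh G"
  obtains t h part where "two_level_topology G t h part"
proof -
  have fine: "fine_mesh G" using assms by (simp add: two_level_mesh_def)
  \<comment> \<open>All facts about the two ends are gathered in one predicate so that a single
    choice yields matching functions \<open>t\<close> and \<open>h\<close>.\<close>
  define Q where "Q j a b \<longleftrightarrow> a < ncells G \<and> b < ncells G \<and>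
    (\<forall>c<ncells G. on_boundary G j c \<longleftrightarrow> c = a \<or> c = b) \<and>
    (\<forall>c<ncells G. \<forall>d<ncells G. oriented_from_to G j c d \<longleftrightarrow> c = a \<and> d = b) \<and>
    (\<forall>c<ncells G. div_mat G $$ (c, j) = of_bool (c = a) - of_bool (c = b))" for j a b
  have "\<exists>a b. Q j a b" if "j < nfaces G" for j
    unfolding Q_def by (rule fine_mesh_face_ends[OF fine that]) blast
  then obtain t h where Q: "\<And>j. j < nfaces G \<Longrightarrow> Q j (t j) (h j)" by metis
  have un: "(\<Union>K<naggs G. agg G K) = {..<ncells G}"
    and disj: "\<And>K L. K < naggs G \<Longrightarrow> L < naggs G \<Longrightarrow> K \<noteq> L \<Longrightarrow> agg G K \<inter> agg G L = {}"
    using assms by (simp_all add: two_level_mesh_def)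
  have "\<exists>K. K < naggs G \<and> c \<in> agg G K" if "c < ncells G" for c
    using un that by blast
  then obtain part where part: "\<And>c. c < ncells G \<Longrightarrow> part c < naggs G \<and> c \<in> agg G (part c)"
    by metis
  have agg: "c \<in> agg G K \<longleftrightarrow> c < ncells G \<and> part c = K" if "K < naggs G" for c K
    using un disj[OF that] part that by blast
  have "two_level_topology G t h part"
    by unfold_locales (use assms Q part agg in \<open>auto simp: Q_def incidence_def\<close>)
  then show ?thesis by (rule that)
qed

section \<open>Coarse faces in terms of the ends of fine faces\<close>

locale two_level_flux = two_level_topology +
  fixes Ups :: "nat \<Rightarrow> nat \<Rightarrow> real"
  assumes Ups_pos: "\<And>a j. a < ncells G \<Longrightarrow> j < nfaces G \<Longrightarrow> on_boundary G j a \<Longrightarrow> Ups a j > 0"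
begin

abbreviation nbr :: "nat \<Rightarrow> nat" where "nbr i \<equiv> fst (cface G i)"
abbreviation nbr' :: "nat \<Rightarrow> nat" where "nbr' i \<equiv> snd (cface G i)"
abbreviation fine_faces :: "nat \<Rightarrow> nat set" where
  "fine_faces i \<equiv> coarse_face G (nbr i) (nbr' i)"

lemma cface_bounds:
  assumes "i < ncfaces G"
  shows "nbr i < nbr' i" "nbr i < naggs G" "nbr' i < naggs G" "fine_faces i \<noteq> {}"
proof -
  have "bij_betw (cface G) {..<ncfaces G}
      {(K, L). K < L \<and> L < naggs G \<and> coarse_face G K L \<noteq> {}}"
    using mesh by (simp add: two_level_mesh_def)
  then have "cface G i \<in> {(K, L). K < L \<and> L < naggs G \<and> coarse_face G K L \<noteq> {}}"
    by (rule bspec[OF bij_betwE]) (use assms in simp)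
  then show "nbr i < nbr' i" "nbr i < naggs G" "nbr' i < naggs G" "fine_faces i \<noteq> {}"
    by auto
qed

lemma coarse_faceI:
  assumes "K < naggs G" "L < naggs G" "k < nfaces G"
    and "part (t k) = K \<and> part (h k) = L \<or> part (t k) = L \<and> part (h k) = K"
  shows "k \<in> coarse_face G K L"
proof -
  have "on_boundary G k (t k)" "on_boundary G k (h k)"
    using assms(3) ends on_boundary_iff by simp_all
  moreover have "t k \<in> agg G K \<and> h k \<in> agg G L \<or> t k \<in> agg G L \<and> h k \<in> agg G K"
    using assms ends by (simp add: agg_iff)
  ultimately show ?thesis using assms(3) unfolding coarse_face_def by blast
qed

text \<open>The orientation convention turns the symmetric adjacency in \<open>coarse_face\<close>
  into a statement about tail and head.\<close>

lemma coarse_face_iff: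
  assumes "K < L" "L < naggs G"
  shows "k \<in> coarse_face G K L \<longleftrightarrow> k < nfaces G \<and> part (t k) = K \<and> part (h k) = L"
proof
  assume k: "k \<in> coarse_face G K L"
  then have "k < nfaces G" by (simp add: coarse_face_def)
  moreover obtain a b where "a \<in> agg G K" "b \<in> agg G L" "oriented_from_to G k a b"
    using mesh k assms unfolding two_level_mesh_def by blast
  ultimately show "k < nfaces G \<and> part (t k) = K \<and> part (h k) = L"
    using assms by (simp add: agg_iff oriented_iff)
next
  assume "k < nfaces G \<and> part (t k) = K \<and> part (h k) = L"
  then show "k \<in> coarse_face G K L"
    using assms by (intro coarse_faceI) auto
qed

section \<open>Solvability of the local problem\<close>

text \<open>Eliminating the flux leaves a weighted Laplacian for the pressure, on the graph of the
  cells of both aggregates and the faces between these cells.\<close>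

lemma local_solution_exists:
  assumes KL: "K < L" "L < naggs G" "coarse_face G K L \<noteq> {}"
  shows "\<exists>\<phi> p. local_solution G Ups K L \<phi> p"
proof -
  have K: "K < naggs G" using KL by simp
  define V where "V = agg G K \<union> agg G L"
  define E where "E = {j. j < nfaces G \<and> t j \<in> V \<and> h j \<in> V}"
  \<comment> \<open>The reciprocal of the resistance in the two-point relation, which then reads:
    flux equals \<open>w j\<close> times the pressure drop.\<close>
  define w where "w j = inverse (inverse (Ups (t j) j) + inverse (Ups (h j) j))" for j
  define r where "r a = (if a \<in> agg G K
    then measure lebesgue (cell G a) / measure lebesgue (coarse_cell G K)
    else - (measure lebesgue (cell G a) / measure lebesgue (coarse_cell G L)))" for a
  have V: "a < ncells G" if "a \<in> V" for a
    using that agg_iff K KL by (auto simp: V_def)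
  have finV: "finite V" using V by (meson finite_lessThan finite_subset lessThan_iff subsetI)
  have disj: "agg G K \<inter> agg G L = {}" using agg_iff K KL by auto
  have neV: "V \<noteq> {}" using mesh K by (auto simp: V_def two_level_mesh_def)
  have wpos: "w j > 0" if "j \<in> E" for j
    using that Ups_pos V on_boundary_iff
    by (simp add: w_def E_def add_pos_pos)
  \<comment> \<open>A pressure without jumps is constant on each aggregate by contiguity; any fine
    face of the coarse face then identifies the two constants.\<close>
  have conn: "p a = p b" if p: "\<And>j. j \<in> E \<Longrightarrow> p (t j) = p (h j)" and "a \<in> V" "b \<in> V"
    for p :: "nat \<Rightarrow> real" and a b
  proof -
    have inner: "p x = p y" if "M = K \<or> M = L" "x \<in> agg G M" "y \<in> agg G M" for M x y
    proof (rule contiguous_imp_constant[OF _ that(2,3)])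
      show "contiguous G (agg G M)"
        using mesh that(1) K KL by (auto simp: two_level_mesh_def)
      fix j x y
      assume j: "j < nfaces G" "x \<in> agg G M" "y \<in> agg G M" "on_boundary G j x" "on_boundary G j y"
      then have "x \<in> V" "y \<in> V" using that(1) by (auto simp: V_def)
      with j V on_boundary_iff have "x = t j \<or> x = h j" "y = t j \<or> y = h j" by blast+
      with \<open>x \<in> V\<close> \<open>y \<in> V\<close> j(1) p[of j] show "p x = p y" by (auto simp: E_def)
    qed
    obtain k where "k \<in> coarse_face G K L" using KL(3) by blast
    then have k: "k < nfaces G" "t k \<in> agg G K" "h k \<in> agg G L"
      using K KL ends by (simp_all add: coarse_face_iff agg_iff)
    then have "p (t k) = p (h k)" by (intro p) (simp add: E_def V_def)
    moreover have "p x = p (t k) \<or> p x = p (h k)" if "x \<in> V" for x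
      using inner that k unfolding V_def by blast
    ultimately show ?thesis using that(2,3) by metis
  qed
  have bal: "(\<Sum>a\<in>V. r a) = 0"
  proof -
    have fin: "finite (agg G K)" "finite (agg G L)" using finV by (simp_all add: V_def)
    have "(\<Sum>a\<in>V. r a) = (\<Sum>a\<in>agg G K. r a) + (\<Sum>a\<in>agg G L. r a)"
      unfolding V_def by (rule sum.union_disjoint[OF fin disj])
    also have "(\<Sum>a\<in>agg G K. r a) = 1"
      using measure_coarse_cell[OF mesh K] by (simp add: r_def flip: sum_divide_distrib)
    also have "(\<Sum>a\<in>agg G L. r a) =
        (\<Sum>a\<in>agg G L. - (measure lebesgue (cell G a) / measure lebesgue (coarse_cell G L)))"
      using disj by (intro sum.cong) (auto simp: r_def)
    also have "\<dots> = - 1"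
      using measure_coarse_cell[OF mesh KL(2)]
      by (simp add: sum_negf flip: sum_divide_distrib)
    finally show ?thesis by simp
  qed
  obtain p where p: "\<And>a. a \<in> V \<Longrightarrow>
      (\<Sum>j\<in>E. incidence t h a j * (w j * (p (t j) - p (h j)))) = r a"
  proof (rule graph_laplacian_solvable[OF finV neV, of E t h w r])
    show "finite E" by (simp add: E_def)
    show "\<And>j. j \<in> E \<Longrightarrow> t j \<in> V" "\<And>j. j \<in> E \<Longrightarrow> h j \<in> V" by (simp_all add: E_def)
  qed (use wpos conn bal in blast)+
  define \<phi> where "\<phi> = vec (nfaces G) (\<lambda>j. if j \<in> E then w j * (p (t j) - p (h j)) else 0)"
  have div: "(div_mat G *\<^sub>v \<phi>) $ a = r a" if a: "a \<in> V" for a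
  proof -
    have "(div_mat G *\<^sub>v \<phi>) $ a = (\<Sum>j<nfaces G. div_mat G $$ (a, j) * \<phi> $ j)"
      using V[OF a] by (simp add: scalar_prod_def div_mat_def \<phi>_def atLeast0LessThan)
    also have "\<dots> = (\<Sum>j\<in>E. div_mat G $$ (a, j) * \<phi> $ j)"
      by (rule sum.mono_neutral_right) (auto simp: E_def \<phi>_def)
    also have "\<dots> = (\<Sum>j\<in>E. incidence t h a j * (w j * (p (t j) - p (h j))))"
      using V[OF a] by (intro sum.cong) (auto simp: \<phi>_def E_def div_mat_index)
    finally show ?thesis using p[OF a] by simp
  qed
  have "local_solution G Ups K L \<phi> p"
    unfolding local_solution_def V_def[symmetric]
  proof (intro conjI allI ballI impI)
    show "\<phi> \<in> carrier_vec (nfaces G)" by (simp add: \<phi>_def)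
    fix j assume j: "j < nfaces G"
    { fix a b assume "a \<in> V" "b \<in> V" "oriented_from_to G j a b"
      then have ab: "a = t j" "b = h j" "j \<in> E" using j V oriented_iff E_def by auto
      with wpos[of j] j show "(inverse (Ups a j) + inverse (Ups b j)) * \<phi> $ j - (p a - p b) = 0"
        by (simp add: \<phi>_def w_def) }
    assume none: "\<not> (\<exists>a\<in>V. \<exists>b\<in>V. oriented_from_to G j a b)"
    have "oriented_from_to G j (t j) (h j)" using oriented_iff ends j by simp
    with none have "j \<notin> E" by (auto simp: E_def)
    with j show "\<phi> $ j = 0" by (simp add: \<phi>_def)
  next
    fix a assume a: "a \<in> agg G K"
    with div[of a] show "(div_mat G *\<^sub>v \<phi>) $ a =
        measure lebesgue (cell G a) / measure lebesgue (coarse_cell G K)"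
      by (simp add: r_def V_def)
  next
    fix a assume a: "a \<in> agg G L"
    with div[of a] disj show "(div_mat G *\<^sub>v \<phi>) $ a =
        - (measure lebesgue (cell G a) / measure lebesgue (coarse_cell G L))"
      by (auto simp: r_def V_def)
  qed
  then show ?thesis by blast
qed

section \<open>Support and normalization of the flux interpolation\<close>

lemma interp_flux_index:
  assumes "i < ncfaces G" "k < nfaces G"
  shows "interp_flux G Ups $$ (k, i) = local_flux G Ups (nbr i) (nbr' i) $ k /
    (\<Sum>l\<in>fine_faces i. local_flux G Ups (nbr i) (nbr' i) $ l)"
  using assms by (simp add: interp_flux_def Let_def split_beta)

text \<open>A face carrying flux of column \<open>i\<close> has both ends in the two aggregates of
  its local problem; if the ends lie in different aggregates, the face joins these two. Faces inside
  an aggregate may carry flux as well.\<close>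

lemma interp_flux_support:
  assumes i: "i < ncfaces G" and k: "k < nfaces G"
    and ne: "part (t k) \<noteq> part (h k)" "interp_flux G Ups $$ (k, i) \<noteq> 0"
  shows "k \<in> fine_faces i"
proof -
  note b = cface_bounds[OF i]
  let ?V = "agg G (nbr i) \<union> agg G (nbr' i)"
  \<comment> \<open>Solvability guarantees that the vector chosen in \<open>local_flux\<close>
    really solves the local problem.\<close>
  have "\<exists>p. local_solution G Ups (nbr i) (nbr' i) (local_flux G Ups (nbr i) (nbr' i)) p"
    unfolding local_flux_def
    by (rule someI_ex) (use local_solution_exists b in blast)
  moreover have "local_flux G Ups (nbr i) (nbr' i) $ k \<noteq> 0"
    using ne(2) interp_flux_index[OF i k] by auto
  ultimately obtain x y where "x \<in> ?V" "y \<in> ?V" "oriented_from_to G k x y"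
    using k unfolding local_solution_def by blast
  then have "part (t k) \<in> {nbr i, nbr' i}" "part (h k) \<in> {nbr i, nbr' i}"
    using b k by (auto simp: agg_iff oriented_iff)
  then consider "part (t k) = nbr i" "part (h k) = nbr' i" | "part (t k) = nbr' i" "part (h k) = nbr i"
    using ne(1) by force
  then show ?thesis
    by cases (simp_all add: coarse_faceI b k)
qed

lemma fine_faces_less: "k \<in> fine_faces i \<Longrightarrow> k < nfaces G"
  by (simp add: coarse_face_def)

lemma part_fine_faces:
  assumes "i < ncfaces G" "k \<in> fine_faces i"
  shows "part (t k) = nbr i" "part (h k) = nbr' i"
  using coarse_face_iff[OF cface_bounds(1,3)[OF assms(1)]] assms(2) by blast+

text \<open>The aggregates of the two ends of \<open>k\<close> determine the pair of coarse cells,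
  and the numbering of coarse faces is injective.\<close>

lemma fine_faces_inj:
  assumes "i < ncfaces G" "i' < ncfaces G" "k \<in> fine_faces i" "k \<in> fine_faces i'"
  shows "i = i'"
proof -
  have "cface G i = cface G i'"
    using part_fine_faces[OF assms(1,3)] part_fine_faces[OF assms(2,4)] by (simp add: prod_eq_iff)
  moreover have "inj_on (cface G) {..<ncfaces G}"
    using mesh by (simp add: two_level_mesh_def bij_betw_def)
  ultimately show ?thesis using assms by (auto dest: inj_onD)
qed

text \<open>By the divergence equations the total flux of the local solution is in fact \<open>1\<close>. This is not
  needed: if it were \<open>0\<close>, the junk value \<open>x / 0 = 0\<close> would make column \<open>i\<close> vanish on the face.\<close>
lemma interp_flux_total:
  assumes i: "i < ncfaces G"
  shows "(\<Sum>k\<in>fine_faces i. interp_flux G Ups $$ (k, i)) = 1 \<or>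
    (\<forall>k\<in>fine_faces i. interp_flux G Ups $$ (k, i) = 0)"
proof -
  let ?S = "\<Sum>l\<in>fine_faces i. local_flux G Ups (nbr i) (nbr' i) $ l"
  have P: "interp_flux G Ups $$ (k, i) = local_flux G Ups (nbr i) (nbr' i) $ k / ?S"
    if "k \<in> fine_faces i" for k
    using interp_flux_index[OF i fine_faces_less[OF that]] .
  show ?thesis
  proof (cases "?S = 0")
    case False
    then have "(\<Sum>k\<in>fine_faces i. interp_flux G Ups $$ (k, i)) = 1"
      by (simp add: P flip: sum_divide_distrib)
    then show ?thesis ..
  qed (simp add: P)
qed

section \<open>Entries of the grid operators\<close>

lemma carriers [simp]:
  "div_mat G \<in> carrier_mat (ncells G) (nfaces G)"
  "upwind_mat G \<sigma> \<in> carrier_mat (nfaces G) (ncells G)"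
  "interp_s G \<in> carrier_mat (ncells G) (naggs G)"
  "restrict_s G \<in> carrier_mat (naggs G) (ncells G)"
  "interp_flux G Ups \<in> carrier_mat (nfaces G) (ncfaces G)"
  "coarse_div G Ups \<in> carrier_mat (naggs G) (ncfaces G)"
  "coarse_upwind G Ups \<sigma>c \<in> carrier_mat (ncfaces G) (naggs G)"
  "v \<in> carrier_vec n \<Longrightarrow> diag_of_vec v \<in> carrier_mat n n"
  by (auto simp: div_mat_def upwind_mat_def interp_s_def interp_flux_def coarse_div_def
      coarse_upwind_def diag_of_vec_def)

lemma interp_s_mult_index:
  assumes "sc \<in> carrier_vec (naggs G)" "c < ncells G"
  shows "(interp_s G *\<^sub>v sc) $ c = sc $ part c"
proof -
  have "(interp_s G *\<^sub>v sc) $ c = (\<Sum>J<naggs G. interp_s G $$ (c, J) * sc $ J)"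
    using assms by (intro mat_vec_index) auto
  also have "\<dots> = (\<Sum>J<naggs G. if J = part c then sc $ part c else 0)"
    using assms by (intro sum.cong) (auto simp: interp_s_def agg_iff)
  finally show ?thesis using part_less[OF assms(2)] by simp
qed

text \<open>Summing the divergence over an aggregate cancels the two contributions of a face inside
  it, leaving an incidence matrix between aggregates.\<close>

lemma restrict_div_index:
  assumes "J < naggs G" "k < nfaces G"
  shows "(restrict_s G * div_mat G) $$ (J, k) = of_bool (J = part (t k)) - of_bool (J = part (h k))"
proof -
  have "(restrict_s G * div_mat G) $$ (J, k) =
      (\<Sum>c<ncells G. restrict_s G $$ (J, c) * div_mat G $$ (c, k))"
    using assms by (intro mat_mult_index) auto
  also have "\<dots> = (\<Sum>c<ncells G. incidence t h c k * of_bool (J = part c))"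
    using assms by (intro sum.cong) (auto simp: interp_s_def agg_iff div_mat_index)
  also have "\<dots> = of_bool (J = part (t k)) - of_bool (J = part (h k))"
    by (rule sum_incidence_mult) (use assms ends in auto)
  finally show ?thesis .
qed

text \<open>Uniqueness of the oriented pair of cells leaves one nonzero entry in row
  \<open>k\<close>. A face with zero flux takes the value of the cell it enters.\<close>

lemma upwind_mult_index:
  assumes x: "x \<in> carrier_vec (ncells G)" and k: "k < nfaces G"
  shows "(upwind_mat G \<sigma> *\<^sub>v x) $ k = x $ (if \<sigma> $ k > 0 then t k else h k)"
proof -
  let ?u = "if \<sigma> $ k > 0 then t k else h k"
  have "(upwind_mat G \<sigma> *\<^sub>v x) $ k = (\<Sum>c<ncells G. upwind_mat G \<sigma> $$ (k, c) * x $ c)"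
    using assms by (intro mat_vec_index) auto
  also have "\<dots> = (\<Sum>c<ncells G. if c = ?u then x $ ?u else 0)"
  proof (intro sum.cong refl)
    fix c assume c: "c \<in> {..<ncells G}"
    have "(\<exists>a<ncells G. \<exists>b<ncells G. oriented_from_to G k a b \<and> c = (if \<sigma> $ k > 0 then a else b))
        \<longleftrightarrow> c = ?u"
      using oriented_iff[OF k] ends[OF k] by metis
    with c k show "upwind_mat G \<sigma> $$ (k, c) * x $ c = (if c = ?u then x $ ?u else 0)"
      by (simp add: upwind_mat_def)
  qed
  finally show ?thesis using ends[OF k] by simp
qed

text \<open>Faces inside an aggregate drop out by cancellation, faces of other coarse faces because
  column \<open>i\<close> vanishes there. The total flux stays as a factor, to be evaluated with
  \<open>interp_flux_total\<close>.\<close>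

lemma coarse_div_index:
  assumes J: "J < naggs G" and i: "i < ncfaces G"
  shows "coarse_div G Ups $$ (J, i) = (of_bool (J = nbr i) - of_bool (J = nbr' i)) *
    (\<Sum>k\<in>fine_faces i. interp_flux G Ups $$ (k, i))"
proof -
  define R where "R k = (of_bool (J = part (t k)) - of_bool (J = part (h k)) :: real)" for k
  have "coarse_div G Ups $$ (J, i) =
      (\<Sum>k<nfaces G. (restrict_s G * div_mat G) $$ (J, k) * interp_flux G Ups $$ (k, i))"
    unfolding coarse_div_def
    by (rule mat_mult_index[OF mult_carrier_mat[OF carriers(4,1)] carriers(5) J i])
  also have "\<dots> = (\<Sum>k<nfaces G. R k * interp_flux G Ups $$ (k, i))"
    by (intro sum.cong refl) (simp only: restrict_div_index[OF J] lessThan_iff R_def)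
  also have "\<dots> = (\<Sum>k\<in>fine_faces i. R k * interp_flux G Ups $$ (k, i))"
  proof (rule sum.mono_neutral_right)
    have "R k = 0 \<or> interp_flux G Ups $$ (k, i) = 0" if "k < nfaces G" "k \<notin> fine_faces i" for k
      using interp_flux_support[OF i that(1)] that(2)
      by (cases "part (t k) = part (h k)") (auto simp: R_def)
    then show "\<forall>k\<in>{..<nfaces G} - fine_faces i. R k * interp_flux G Ups $$ (k, i) = 0"
      by auto
  qed (auto simp: fine_faces_less)
  also have "\<dots> = (\<Sum>k\<in>fine_faces i.
      (of_bool (J = nbr i) - of_bool (J = nbr' i)) * interp_flux G Ups $$ (k, i))"
    by (intro sum.cong refl) (simp only: R_def part_fine_faces[OF i])
  finally show ?thesis by (simp only: sum_distrib_left)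
qed

text \<open>The row is written as one sum over fine faces, ready for comparison with the fine upwind
  fluxes face by face.\<close>

lemma coarse_upwind_mult_index:
  assumes i: "i < ncfaces G" and x: "x \<in> carrier_vec (naggs G)"
  shows "(coarse_upwind G Ups \<sigma>c *\<^sub>v x) $ i =
    (\<Sum>k\<in>fine_faces i. if \<sigma>c $ i > 0
      then max (interp_flux G Ups $$ (k, i)) 0 * x $ nbr i + min (interp_flux G Ups $$ (k, i)) 0 * x $ nbr' i
      else min (interp_flux G Ups $$ (k, i)) 0 * x $ nbr i + max (interp_flux G Ups $$ (k, i)) 0 * x $ nbr' i)"
    (is "_ = ?rhs")
proof -
  note b = cface_bounds[OF i]
  define pos where "pos = (\<Sum>k\<in>fine_faces i. max (interp_flux G Ups $$ (k, i)) 0)"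
  define neg where "neg = (\<Sum>k\<in>fine_faces i. min (interp_flux G Ups $$ (k, i)) 0)"
  have delta: "(\<Sum>j<naggs G. (of_bool (j = K) * c + of_bool (j = L) * d) * x $ j) = c * x $ K + d * x $ L"
    if "K < naggs G" "L < naggs G" for K L and c d :: real
  proof -
    have "(of_bool (j = K) * c + of_bool (j = L) * d) * x $ j =
        (if j = K then c * x $ K else 0) + (if j = L then d * x $ L else 0)" for j
      by (auto simp: distrib_right)
    with that show ?thesis by (simp add: sum.distrib)
  qed
  have "(coarse_upwind G Ups \<sigma>c *\<^sub>v x) $ i = (\<Sum>j<naggs G. coarse_upwind G Ups \<sigma>c $$ (i, j) * x $ j)"
    using i x by (intro mat_vec_index) auto
  also have "\<dots> = (\<Sum>j<naggs G. (if \<sigma>c $ i > 0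
      then of_bool (j = nbr i) * pos + of_bool (j = nbr' i) * neg
      else of_bool (j = nbr i) * neg + of_bool (j = nbr' i) * pos) * x $ j)"
    using i by (intro sum.cong) (auto simp: coarse_upwind_def Let_def split_beta pos_def neg_def)
  also have "\<dots> = (if \<sigma>c $ i > 0 then pos * x $ nbr i + neg * x $ nbr' i
      else neg * x $ nbr i + pos * x $ nbr' i)"
    using delta b by simp
  also have "\<dots> = ?rhs"
    by (simp add: pos_def neg_def sum.distrib sum_distrib_right)
  finally show ?thesis .
qed

section \<open>Comparison of fine and coarse upwind fluxes\<close>

lemma coarse_transport_eq:
  assumes flux: "\<sigma>c \<in> carrier_vec (ncfaces G)" and sat: "sc \<in> carrier_vec (naggs G)"
  shows "coarse_transport G Ups f \<sigma>c sc =
    (coarse_div G Ups * diag_of_vec \<sigma>c * coarse_upwind G Ups \<sigma>c) *\<^sub>v map_vec f sc"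
proof (rule eq_vecI)
  let ?P = "interp_flux G Ups"
  define \<sigma> where "\<sigma> = ?P *\<^sub>v \<sigma>c"
  define s where "s = interp_s G *\<^sub>v sc"
  define x where "x = map_vec f sc"
  \<comment> \<open>The upwind aggregate of face \<open>k\<close>; inside an aggregate both
    alternatives coincide.\<close>
  define u where "u k = (if \<sigma> $ k > 0 then part (t k) else part (h k))" for k
  define R where "R J k = (of_bool (J = part (t k)) - of_bool (J = part (h k)) :: real)" for J k
  have \<sigma>: "\<sigma> \<in> carrier_vec (nfaces G)" and s: "s \<in> carrier_vec (ncells G)"
    and x: "x \<in> carrier_vec (naggs G)"
    using mult_mat_vec_carrier[OF carriers(5) flux] mult_mat_vec_carrier[OF carriers(3) sat] sat
    by (simp_all add: \<sigma>_def s_def x_def)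
  have \<sigma>k: "\<sigma> $ k = (\<Sum>i<ncfaces G. ?P $$ (k, i) * \<sigma>c $ i)" if "k < nfaces G" for k
    unfolding \<sigma>_def using flux that by (intro mat_vec_index) auto
  have up: "(upwind_mat G \<sigma> *\<^sub>v map_vec f s) $ k = x $ u k" if "k < nfaces G" for k
    using that s sat ends[OF that] part_less
    by (simp add: upwind_mult_index u_def x_def) (simp add: s_def interp_s_mult_index)
  have lhs: "coarse_transport G Ups f \<sigma>c sc =
      (restrict_s G * div_mat G) *\<^sub>v vec (nfaces G) (\<lambda>k. \<sigma> $ k * x $ u k)"
  proof -
    let ?v = "upwind_mat G \<sigma> *\<^sub>v map_vec f s"
    have v: "?v \<in> carrier_vec (nfaces G)" by (rule mult_mat_vec_carrier[OF carriers(2)]) (use s in simp)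
    have "(div_mat G * diag_of_vec \<sigma> * upwind_mat G \<sigma>) *\<^sub>v map_vec f s =
        div_mat G *\<^sub>v (diag_of_vec \<sigma> *\<^sub>v ?v)"
      by (rule mult3_mat_vec[OF carriers(1) carriers(8)[OF \<sigma>] carriers(2)]) (use s in simp)
    also have "diag_of_vec \<sigma> *\<^sub>v ?v = vec (nfaces G) (\<lambda>k. \<sigma> $ k * x $ u k)"
      unfolding diag_of_vec_mult[OF \<sigma> v] by (rule eq_vecI) (simp_all only: index_vec dim_vec up)
    finally show ?thesis
      unfolding coarse_transport_def transport_def \<sigma>_def[symmetric] s_def[symmetric]
      by (simp only: assoc_mult_mat_vec[OF carriers(4,1) vec_carrier])
  qed
  define y where "y = coarse_upwind G Ups \<sigma>c *\<^sub>v x"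
  have y: "y \<in> carrier_vec (ncfaces G)" unfolding y_def by (rule mult_mat_vec_carrier[OF carriers(7) x])
  have rhs: "(coarse_div G Ups * diag_of_vec \<sigma>c * coarse_upwind G Ups \<sigma>c) *\<^sub>v x =
      coarse_div G Ups *\<^sub>v vec (ncfaces G) (\<lambda>i. \<sigma>c $ i * y $ i)"
    unfolding diag_of_vec_mult[OF flux y, symmetric] unfolding y_def
    by (rule mult3_mat_vec[OF carriers(6) carriers(8)[OF flux] carriers(7) x])
  show "dim_vec (coarse_transport G Ups f \<sigma>c sc) =
      dim_vec ((coarse_div G Ups * diag_of_vec \<sigma>c * coarse_upwind G Ups \<sigma>c) *\<^sub>v map_vec f sc)"
    unfolding lhs x_def[symmetric] rhs
    by (simp add: carrier_matD[OF carriers(3)] carrier_matD[OF carriers(6)])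
  fix J assume "J < dim_vec ((coarse_div G Ups * diag_of_vec \<sigma>c * coarse_upwind G Ups \<sigma>c) *\<^sub>v map_vec f sc)"
  then have J: "J < naggs G" by (simp add: carrier_matD[OF carriers(6)])
  \<comment> \<open>A face between different aggregates lies on only one coarse face, so all other
    columns vanish on it.\<close>
  have \<sigma>_face: "\<sigma> $ k = ?P $$ (k, i) * \<sigma>c $ i" if i: "i < ncfaces G" and k: "k \<in> fine_faces i" for i k
  proof -
    have kn: "k < nfaces G" using k by (rule fine_faces_less)
    have ne: "part (t k) \<noteq> part (h k)" using cface_bounds(1)[OF i] part_fine_faces[OF i k] by simp
    have other: "?P $$ (k, i') = 0" if "i' < ncfaces G" "i' \<noteq> i" for i'
      using interp_flux_support[OF that(1) kn ne] fine_faces_inj[OF i that(1) k] that(2) by blast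
    have "\<sigma> $ k = (\<Sum>i'<ncfaces G. if i' = i then ?P $$ (k, i) * \<sigma>c $ i else 0)"
      unfolding \<sigma>k[OF kn] by (intro sum.cong) (simp_all add: other)
    then show ?thesis using i by simp
  qed
  have "coarse_transport G Ups f \<sigma>c sc $ J = (\<Sum>k<nfaces G. R J k * (\<sigma> $ k * x $ u k))"
    unfolding lhs mat_vec_index[OF mult_carrier_mat[OF carriers(4,1)] vec_carrier J]
    by (intro sum.cong refl) (simp only: restrict_div_index[OF J] lessThan_iff R_def index_vec)
  \<comment> \<open>Only the flux factor is split into columns; \<open>u k\<close> still refers to
    the sign of the whole fine flux, which \<open>\<sigma>_face\<close> reduces to column
    \<open>i\<close> on coarse face \<open>i\<close>.\<close>
  also have "\<dots> = (\<Sum>i<ncfaces G. \<Sum>k<nfaces G. R J k * (?P $$ (k, i) * \<sigma>c $ i * x $ u k))"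
    by (subst sum.swap) (intro sum.cong refl, simp only: \<sigma>k lessThan_iff sum_distrib_left sum_distrib_right)
  also have "\<dots> = (\<Sum>i<ncfaces G. coarse_div G Ups $$ (J, i) * (\<sigma>c $ i * y $ i))"
  proof (intro sum.cong refl)
    fix i assume "i \<in> {..<ncfaces G}"
    then have i: "i < ncfaces G" by simp
    define d where "d = (of_bool (J = nbr i) - of_bool (J = nbr' i) :: real)"
    have "(\<Sum>k<nfaces G. R J k * (?P $$ (k, i) * \<sigma>c $ i * x $ u k)) =
        (\<Sum>k\<in>fine_faces i. R J k * (?P $$ (k, i) * \<sigma>c $ i * x $ u k))"
    proof (rule sum.mono_neutral_right)
      have "R J k = 0 \<or> ?P $$ (k, i) = 0" if "k < nfaces G" "k \<notin> fine_faces i" for k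
        using interp_flux_support[OF i that(1)] that(2)
        by (cases "part (t k) = part (h k)") (auto simp: R_def)
      then show "\<forall>k\<in>{..<nfaces G} - fine_faces i. R J k * (?P $$ (k, i) * \<sigma>c $ i * x $ u k) = 0"
        by auto
    qed (auto simp: fine_faces_less)
    also have "\<dots> = (\<Sum>k\<in>fine_faces i. d * (\<sigma>c $ i * (if \<sigma>c $ i > 0
      then max (?P $$ (k, i)) 0 * x $ nbr i + min (?P $$ (k, i)) 0 * x $ nbr' i
      else min (?P $$ (k, i)) 0 * x $ nbr i + max (?P $$ (k, i)) 0 * x $ nbr' i)))"
    proof (intro sum.cong refl)
      fix k assume k: "k \<in> fine_faces i"
      note pk = part_fine_faces[OF i k]
      \<comment> \<open>The sign of \<open>?P $$ (k, i) * \<sigma>c $ i\<close> selects the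
        aggregate, and \<open>max\<close> and \<open>min\<close> keep the matching term. If the
        product is zero, both sides are zero, so the tie rule does no harm.\<close>
      have "?P $$ (k, i) * \<sigma>c $ i * x $ u k = \<sigma>c $ i * (if \<sigma>c $ i > 0
          then max (?P $$ (k, i)) 0 * x $ nbr i + min (?P $$ (k, i)) 0 * x $ nbr' i
          else min (?P $$ (k, i)) 0 * x $ nbr i + max (?P $$ (k, i)) 0 * x $ nbr' i)"
        unfolding u_def \<sigma>_face[OF i k] pk
        by (auto simp: zero_less_mult_iff max_def min_def not_less)
      then show "R J k * (?P $$ (k, i) * \<sigma>c $ i * x $ u k) = d * (\<sigma>c $ i * (if \<sigma>c $ i > 0
          then max (?P $$ (k, i)) 0 * x $ nbr i + min (?P $$ (k, i)) 0 * x $ nbr' i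
          else min (?P $$ (k, i)) 0 * x $ nbr i + max (?P $$ (k, i)) 0 * x $ nbr' i))"
        by (simp only: R_def d_def pk)
    qed
    also have "\<dots> = d * (\<sigma>c $ i * y $ i)"
      by (simp only: y_def coarse_upwind_mult_index[OF i x] sum_distrib_left)
    \<comment> \<open>The factor in the coarse divergence is 1, or else column \<open>i\<close>
      vanishes on the whole coarse face and \<open>y $ i\<close> is zero too.\<close>
    also have "\<dots> = coarse_div G Ups $$ (J, i) * (\<sigma>c $ i * y $ i)"
      using interp_flux_total[OF i]
    proof
      assume "\<forall>k\<in>fine_faces i. ?P $$ (k, i) = 0"
      then have "y $ i = 0" unfolding y_def coarse_upwind_mult_index[OF i x]
        by (intro sum.neutral) auto
      then show ?thesis by simp
    qed (simp add: coarse_div_index[OF J i] d_def)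
    finally show "(\<Sum>k<nfaces G. R J k * (?P $$ (k, i) * \<sigma>c $ i * x $ u k)) =
      coarse_div G Ups $$ (J, i) * (\<sigma>c $ i * y $ i)" .
  qed
  also have "\<dots> = ((coarse_div G Ups * diag_of_vec \<sigma>c * coarse_upwind G Ups \<sigma>c) *\<^sub>v map_vec f sc) $ J"
    unfolding x_def[symmetric] rhs mat_vec_index[OF carriers(6) vec_carrier J]
    by (intro sum.cong refl) (simp only: lessThan_iff index_vec)
  finally show "coarse_transport G Ups f \<sigma>c sc $ J =
      ((coarse_div G Ups * diag_of_vec \<sigma>c * coarse_upwind G Ups \<sigma>c) *\<^sub>v map_vec f sc) $ J" .
qed

end

theorem proposition1:
  fixes G :: two_level_grid
    and Ups :: "nat \<Rightarrow> nat \<Rightarrow> real"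
    and lam_w lam_nw :: "real \<Rightarrow> real"
    and \<sigma>c sc :: "real vec"
  assumes mesh: "two_level_mesh G"
    and Ups_pos: "\<And>a j. a < ncells G \<Longrightarrow> j < nfaces G \<Longrightarrow> on_boundary G j a \<Longrightarrow> Ups a j > 0"
    and mobility_pos: "\<And>s. lam_w s + lam_nw s > 0"
    and flux: "\<sigma>c \<in> carrier_vec (ncfaces G)"
    and saturation: "sc \<in> carrier_vec (naggs G)"
  shows "coarse_transport G Ups (frac_flow lam_w lam_nw) \<sigma>c sc =
    (coarse_div G Ups * diag_of_vec \<sigma>c * coarse_upwind G Ups \<sigma>c)
      *\<^sub>v map_vec (frac_flow lam_w lam_nw) sc"
proof -
  obtain t h part where "two_level_topology G t h part"
    using two_level_mesh_topology[OF mesh] .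
  then interpret two_level_topology G t h part .
  interpret two_level_flux G t h part Ups
    by unfold_locales (rule Ups_pos)
  show ?thesis using flux saturation by (rule coarse_transport_eq)
qed

end
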